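(* Let $m\ge1$ be an integer, $n=2m$, and let $C=a\,C_a\oplus b\,C_b$ be an $H_{23}$-code of length $2m$, with binary component $C_a\subseteq\mathbb{F}_2^{n}$ and ternary component $C_b\subseteq\mathbb{F}_3^{n}$. Then $C$ is symplectic self-dual if and only if $C_a$ is a binary symplectic self-dual code and $C_b=\mathbb{F}_3^n$.
   Context: Ring: $H_{23}=\langle a,b\mid 2a=0,\ 3b=0,\ a^2=a,\ b^2=0,\ ab=ba=0\rangle$ is the commutative non-unital ring of order six with elements $0,a,b,a+b,2b,a+2b$. For $\mathbf{x}\in\mathbb{F}_2^n$, $a\mathbf{x}$ is the vector obtained coordinatewise from $a\cdot0=0$, $a\cdot1=a$; for $\mathbf{y}\in\mathbb{F}_3^n$, $b\mathbf{y}$ is obtained coordinatewise from $b\cdot0=0$, $b\cdot1=b$, $b\cdot2=2b$. Every vector of $H_{23}^n$ is uniquely $a\mathbf{x}+b\mathbf{y}$ with $\mathbf{x}\in\mathbb{F}_2^n$, $\mathbf{y}\in\mathbb{F}_3^n$. Codes: an $H_{23}$-code of length $n$ is an $H_{23}$-submodule $C\subseteq H_{23}^n$ (an additive subgroup closed under multiplication by elements of $H_{23}$). It decomposes as $C=aC_a\oplus bC_b=\{a\mathbf{u}+b\mathbf{v}: \mathbf{u}\in C_a,\mathbf{v}\in C_b\}$ with $C_a=\{\mathbf{u}\in\mathbb{F}_2^n: a\mathbf{u}\in C\}$ and $C_b=\{\mathbf{v}\in\mathbb{F}_3^n: b\mathbf{v}\in C\}$, which are linear codes over $\mathbb{F}_2$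 and $\mathbb{F}_3$ respectively. Symplectic forms: for $\mathbf{x}=(\mathbf{x}_1\mid\mathbf{x}_2),\mathbf{y}=(\mathbf{y}_1\mid\mathbf{y}_2)\in\mathbb{F}_2^{2m}$ with $\mathbf{x}_i,\mathbf{y}_i\in\mathbb{F}_2^m$, set $\langle\mathbf{x},\mathbf{y}\rangle_s^{(\mathbb{F}_2)}=\mathbf{x}_1\cdot\mathbf{y}_2+\mathbf{x}_2\cdot\mathbf{y}_1$, where $\cdot$ is the usual dot product. For $\mathbf{c}=a\mathbf{x}+b\mathbf{y}$, $\mathbf{c}'=a\mathbf{x}'+b\mathbf{y}'$ in $H_{23}^{2m}$ (with $\mathbf{x},\mathbf{x}'\in\mathbb{F}_2^{2m}$, $\mathbf{y},\mathbf{y}'\in\mathbb{F}_3^{2m}$), set $\langle\mathbf{c},\mathbf{c}'\rangle_S=a\langle\mathbf{x},\mathbf{x}'\rangle_s^{(\mathbb{F}_2)}$ (the ternary part contributes $0$ because $b^2=0$). The symplectic dual $C^{\perp_S}$ of a code $C$ (over $\mathbb{F}_2$ or $H_{23}$, of length $2m$) is the set of all vectors of the ambient space orthogonal to every element of $C$ under the corresponding symplectic form. $C$ is symplectic self-dual if $C=C^{\perp_S}$. *)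

theory Defs
  imports "HOL-Library.Numeral_Type" "Jordan_Normal_Form.Matrix"
begin

text \<open>
  The fields with two and three elements are the types \<^typ>\<open>2\<close> and \<^typ>\<open>3\<close> of integers modulo 2
  and 3. Vectors of length \<open>n\<close> are the elements of \<^term>\<open>carrier_vec n\<close>.
\<close>

section \<open>The ring\<close>

text \<open>\<open>H23 x y\<close> stands for \<open>ax + by\<close>; since \<open>a\<^sup>2 = a\<close>, \<open>b\<^sup>2 = 0\<close> and \<open>ab = ba = 0\<close>, the product
  only keeps the binary coordinates.\<close>

datatype h23 = H23 (bin: "2") (ter: "3")

instantiation h23 :: comm_ring
begin

definition zero_h23 :: h23 where "0 = H23 0 0"
definition plus_h23 :: "h23 \<Rightarrow> h23 \<Rightarrow> h23"
  where "p + q = H23 (bin p + bin q) (ter p + ter q)"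
definition uminus_h23 :: "h23 \<Rightarrow> h23" where "- p = H23 (- bin p) (- ter p)"
definition minus_h23 :: "h23 \<Rightarrow> h23 \<Rightarrow> h23"
  where "p - q = H23 (bin p - bin q) (ter p - ter q)"
definition times_h23 :: "h23 \<Rightarrow> h23 \<Rightarrow> h23" where "p * q = H23 (bin p * bin q) 0"

instance
  by standard
    (auto simp: zero_h23_def plus_h23_def uminus_h23_def minus_h23_def times_h23_def algebra_simps
       intro: h23.expand)

end

definition ha :: h23 where "ha = H23 1 0"
definition hb :: h23 where "hb = H23 0 1"

lemmas h23_defs = zero_h23_def plus_h23_def uminus_h23_def minus_h23_def times_h23_def
  ha_def hb_def

lemma exhaust_2': "(x :: 2) = 0 \<or> x = 1"
proof (cases x)
  case (of_int z)
  then have "z = 0 \<or> z = 1" by auto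
  with of_int show ?thesis by auto
qed

lemma exhaust_3': "(x :: 3) = 0 \<or> x = 1 \<or> x = 2"
proof (cases x)
  case (of_int z)
  then have "z = 0 \<or> z = 1 \<or> z = 2" by auto
  with of_int show ?thesis by auto
qed

lemma h23_relations:
  "ha + ha = 0" "hb + hb + hb = 0" "ha * ha = ha" "hb * hb = 0" "ha * hb = 0" "hb * ha = 0"
  by (simp_all add: h23_defs)

lemma h23_UNIV: "(UNIV :: h23 set) = {0, ha, hb, ha + hb, hb + hb, ha + (hb + hb)}"
proof -
  have "p \<in> {0, ha, hb, ha + hb, hb + hb, ha + (hb + hb)}" for p
    using exhaust_2'[of "bin p"] exhaust_3'[of "ter p"] by (cases p) (auto simp: h23_defs)
  then show ?thesis by auto
qed

lemma h23_card: "card (UNIV :: h23 set) = 6"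
  by (simp add: h23_UNIV h23_defs)

definition a_mult :: "2 \<Rightarrow> h23" where
  "a_mult x = (if x = 0 then 0 else ha)"

definition b_mult :: "3 \<Rightarrow> h23" where
  "b_mult y = (if y = 0 then 0 else if y = 1 then hb else hb + hb)"

lemma a_mult_eq: "a_mult x = H23 x 0"
  using exhaust_2'[of x] by (auto simp: a_mult_def h23_defs)

lemma b_mult_eq: "b_mult y = H23 0 y"
  using exhaust_3'[of y] by (auto simp: b_mult_def h23_defs)

abbreviation a_vec :: "2 vec \<Rightarrow> h23 vec" where "a_vec \<equiv> map_vec a_mult"
abbreviation b_vec :: "3 vec \<Rightarrow> h23 vec" where "b_vec \<equiv> map_vec b_mult"

lemma h23_vec_decomp:
  "c = a_vec (map_vec bin c) + b_vec (map_vec ter c)"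
  by (rule eq_vecI) (auto simp: a_mult_eq b_mult_eq plus_h23_def)

lemma h23_vec_unique:
  assumes "x \<in> carrier_vec n" "y \<in> carrier_vec n"
  shows "map_vec bin (a_vec x + b_vec y) = x" "map_vec ter (a_vec x + b_vec y) = y"
  using assms by (auto simp: a_mult_eq b_mult_eq plus_h23_def)

section \<open>Codes\<close>

definition h23_code :: "nat \<Rightarrow> h23 vec set \<Rightarrow> bool" where
  "h23_code n C \<longleftrightarrow> C \<subseteq> carrier_vec n \<and> 0\<^sub>v n \<in> C \<and>
     (\<forall>c\<in>C. \<forall>d\<in>C. c + d \<in> C) \<and> (\<forall>c\<in>C. - c \<in> C) \<and> (\<forall>r. \<forall>c\<in>C. r \<cdot>\<^sub>v c \<in> C)"

definition bin_comp :: "nat \<Rightarrow> h23 vec set \<Rightarrow> 2 vec set" where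
  "bin_comp n C = {u \<in> carrier_vec n. a_vec u \<in> C}"

definition ter_comp :: "nat \<Rightarrow> h23 vec set \<Rightarrow> 3 vec set" where
  "ter_comp n C = {v \<in> carrier_vec n. b_vec v \<in> C}"

lemma h23_code_decomp:
  assumes "h23_code n C"
  shows "C = {a_vec u + b_vec v |u v. u \<in> bin_comp n C \<and> v \<in> ter_comp n C}"
proof (intro equalityI subsetI)
  fix c assume c: "c \<in> C"
  have car: "c \<in> carrier_vec n" using assms c by (auto simp: h23_code_def)
  have a: "ha \<cdot>\<^sub>v c = a_vec (map_vec bin c)"
    by (rule eq_vecI) (auto simp: a_mult_eq times_h23_def ha_def)
  have b: "c + - (ha \<cdot>\<^sub>v c) = b_vec (map_vec ter c)"
    by (rule eq_vecI) (auto simp: b_mult_eq h23_defs)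
  have "ha \<cdot>\<^sub>v c \<in> C" "c + - (ha \<cdot>\<^sub>v c) \<in> C" using assms c by (simp_all add: h23_code_def)
  then have "map_vec bin c \<in> bin_comp n C" "map_vec ter c \<in> ter_comp n C"
    using a b car by (simp_all add: bin_comp_def ter_comp_def)
  then show "c \<in> {a_vec u + b_vec v |u v. u \<in> bin_comp n C \<and> v \<in> ter_comp n C}"
    using h23_vec_decomp by blast
next
  fix c assume "c \<in> {a_vec u + b_vec v |u v. u \<in> bin_comp n C \<and> v \<in> ter_comp n C}"
  then show "c \<in> C" using assms by (auto simp: bin_comp_def ter_comp_def h23_code_def)
qed

section \<open>Symplectic forms and duals\<close>

definition symp_bin :: "nat \<Rightarrow> 2 vec \<Rightarrow> 2 vec \<Rightarrow> 2" where
  "symp_bin m x y = vec_first x m \<bullet> vec_last y m + vec_last x m \<bullet> vec_first y m"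

definition symp_h23 :: "nat \<Rightarrow> h23 vec \<Rightarrow> h23 vec \<Rightarrow> h23" where
  "symp_h23 m c d = a_mult (symp_bin m (map_vec bin c) (map_vec bin d))"

lemma symp_h23_eq:
  assumes "x \<in> carrier_vec (2 * m)" "y \<in> carrier_vec (2 * m)"
    and "x' \<in> carrier_vec (2 * m)" "y' \<in> carrier_vec (2 * m)"
  shows "symp_h23 m (a_vec x + b_vec y) (a_vec x' + b_vec y') = a_mult (symp_bin m x x')"
  using assms by (simp add: symp_h23_def h23_vec_unique)

definition symp_dual_bin :: "nat \<Rightarrow> 2 vec set \<Rightarrow> 2 vec set" where
  "symp_dual_bin m D = {x \<in> carrier_vec (2 * m). \<forall>y\<in>D. symp_bin m x y = 0}"

definition symp_dual_h23 :: "nat \<Rightarrow> h23 vec set \<Rightarrow> h23 vec set" where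
  "symp_dual_h23 m C = {c \<in> carrier_vec (2 * m). \<forall>d\<in>C. symp_h23 m c d = 0}"

definition symp_self_dual_bin :: "nat \<Rightarrow> 2 vec set \<Rightarrow> bool" where
  "symp_self_dual_bin m D \<longleftrightarrow> D = symp_dual_bin m D"

definition symp_self_dual_h23 :: "nat \<Rightarrow> h23 vec set \<Rightarrow> bool" where
  "symp_self_dual_h23 m C \<longleftrightarrow> C = symp_dual_h23 m C"

end

(* The form only sees binary parts, so the dual of C is the symplectic dual of C_a in the binary
   coordinate and everything in the ternary coordinate; comparing components gives the claim. *)
theory Submission imports Defs begin

text \<open>In the coordinates (u, v) of \<open>a_vec u + b_vec v\<close>, both \<open>C\<close> and
  its dual are products. By \<open>mem_h23_code_iff\<close>, \<open>C\<close> is C_a times C_b; by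
  \<open>symp_dual_h23_iff\<close>, the dual is the binary symplectic dual of C_a times the whole
  ternary space. Nonempty products agree exactly when their factors do.\<close>

lemma mem_h23_code_iff:
  assumes "h23_code n C"
  shows "c \<in> C \<longleftrightarrow> map_vec bin c \<in> bin_comp n C \<and> map_vec ter c \<in> ter_comp n C"
proof
  assume "c \<in> C"
  then obtain u v where "c = a_vec u + b_vec v" "u \<in> bin_comp n C" "v \<in> ter_comp n C"
    using h23_code_decomp[OF assms] by blast
  moreover from this have "u \<in> carrier_vec n" "v \<in> carrier_vec n"
    by (auto simp: bin_comp_def ter_comp_def)
  ultimately show "map_vec bin c \<in> bin_comp n C \<and> map_vec ter c \<in> ter_comp n C"
    by (metis h23_vec_unique)
next
  assume "map_vec bin c \<in> bin_comp n C \<and> map_vec ter c \<in> ter_comp n C"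
  then show "c \<in> C"
    using h23_code_decomp[OF assms] h23_vec_decomp[of c] by blast
qed

lemma zero_mem_comps:
  assumes "h23_code n C"
  shows "0\<^sub>v n \<in> bin_comp n C" "0\<^sub>v n \<in> ter_comp n C"
proof -
  have "a_vec (0\<^sub>v n) = 0\<^sub>v n" "b_vec (0\<^sub>v n) = 0\<^sub>v n"
    by (rule eq_vecI; simp add: a_mult_def b_mult_def)+
  then show "0\<^sub>v n \<in> bin_comp n C" "0\<^sub>v n \<in> ter_comp n C"
    using assms by (simp_all add: bin_comp_def ter_comp_def h23_code_def)
qed

text \<open>Each u in C_a lifts to \<open>C\<close> with ternary part zero. Hence orthogonality to
  all of \<open>C\<close> can be tested on C_a.\<close>

lemma bin_image_h23_code:
  assumes "h23_code n C"
  shows "map_vec bin ` C = bin_comp n C"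
proof (intro equalityI subsetI)
  fix u assume u: "u \<in> bin_comp n C"
  then have "u \<in> carrier_vec n" by (simp add: bin_comp_def)
  then have "map_vec bin (a_vec u + b_vec (0\<^sub>v n)) = u"
    by (rule h23_vec_unique) simp
  moreover have "a_vec u + b_vec (0\<^sub>v n) \<in> C"
    using h23_code_decomp[OF assms] u zero_mem_comps(2)[OF assms] by blast
  ultimately show "u \<in> map_vec bin ` C" by (metis imageI)
qed (use mem_h23_code_iff[OF assms] in blast)

text \<open>The form depends only on binary parts, and \<open>a_mult\<close> vanishes only at 0.
  Since \<open>map_vec\<close> keeps the length, the ambient-space conditions match too.\<close>

lemma symp_dual_h23_iff:
  assumes "h23_code (2 * m) C"
  shows "c \<in> symp_dual_h23 m C \<longleftrightarrow> map_vec bin c \<in> symp_dual_bin m (bin_comp (2 * m) C)"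
  unfolding bin_image_h23_code[OF assms, symmetric]
  by (auto simp: symp_dual_h23_def symp_dual_bin_def symp_h23_def a_mult_eq zero_h23_def)

theorem theorem4p10:
  fixes m n :: nat and C :: "h23 vec set"
  assumes "m \<ge> 1" and "n = 2 * m" and "h23_code n C"
  shows "symp_self_dual_h23 m C \<longleftrightarrow>
    symp_self_dual_bin m (bin_comp n C) \<and> ter_comp n C = carrier_vec n"
proof -
  let ?A = "bin_comp n C" and ?B = "ter_comp n C"
  let ?D = "symp_dual_bin m ?A"
  have sub: "?A \<subseteq> carrier_vec n" "?B \<subseteq> carrier_vec n" "?D \<subseteq> carrier_vec n"
    using assms(2) by (auto simp: bin_comp_def ter_comp_def symp_dual_bin_def)
  note zero = zero_mem_comps[OF assms(3)]
  have "symp_self_dual_h23 m C \<longleftrightarrow>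
    (\<forall>c. (map_vec bin c \<in> ?A \<and> map_vec ter c \<in> ?B) = (map_vec bin c \<in> ?D))"
    unfolding symp_self_dual_h23_def set_eq_iff
    using mem_h23_code_iff[OF assms(3)] symp_dual_h23_iff[of m C] assms(2,3) by simp
  also have "\<dots> \<longleftrightarrow> (\<forall>u\<in>carrier_vec n. \<forall>v\<in>carrier_vec n. (u \<in> ?A \<and> v \<in> ?B) = (u \<in> ?D))"
    (is "?L = ?R")
  proof
    \<comment> \<open>Every pair (u, v) arises from the vector
      \<open>a_vec u + b_vec v\<close>.\<close>
    show "?L \<Longrightarrow> ?R" by (metis h23_vec_unique)
    assume R: ?R
    show ?L
    proof
      fix c
      show "(map_vec bin c \<in> ?A \<and> map_vec ter c \<in> ?B) = (map_vec bin c \<in> ?D)"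
      proof (cases "c \<in> carrier_vec n")
        case True
        then show ?thesis using R by simp
      next
        case False
        \<comment> \<open>A vector of the wrong length makes both sides false.\<close>
        then have "map_vec bin c \<notin> carrier_vec n" by simp
        then show ?thesis using sub by blast
      qed
    qed
  qed
  \<comment> \<open>Taking v = 0 gives \<open>?A = ?D\<close>; then u = 0, which lies in both,
    forces every v into \<open>?B\<close>.\<close>
  also have "\<dots> \<longleftrightarrow> ?A = ?D \<and> ?B = carrier_vec n"
    using zero sub by blast
  finally show ?thesis by (simp add: symp_self_dual_bin_def)
qed

end
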